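(* Let $n\equiv 1 \pmod 4$, let $p>0$ be an integer, and suppose $n\geq 4p+3$. Then there exists a globally simple integer Heffter array $H(n;4p+3)$.
   Context: A Heffter array $H(n;k)$ is an $n\times n$ array of integers (some cells may be empty) such that: each row and each column contains exactly $k$ filled cells; the entries in every row and every column sum to $0$ modulo $2nk+1$; and for each integer $1\leq x\leq nk$, either $x$ or $-x$ appears in the array. It is an integer Heffter array if every row sum and every column sum is $0$ in $\mathbb{Z}$. Rows and columns are indexed by $0,1,\dots,n-1$. The natural ordering of a row lists its filled cells from left to right (increasing column index), and that of a column from top to bottom (increasing row index). The array is globally simple if, for every row and every column, writing its entries in natural order as $a_0,\dots,a_{k-1}$, the partial sums $\sum_{j=0}^{i}a_j$, $i=0,\dots,k-1$, are pairwise distinct modulo $2nk+1$. *)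

theory Defs
  imports "HOL-Number_Theory.Cong"
begin

text \<open>
  An \<open>n \<times> n\<close> array, rows and columns indexed by \<open>0, \<dots>, n - 1\<close>, is a function
  \<open>A\<close> with \<open>A r c = None\<close> if cell \<open>(r, c)\<close> is empty and \<open>A r c = Some x\<close> if it
  contains \<open>x\<close>. Since \<open>n\<close> is not part of the type, it is passed explicitly; values of
  \<open>A\<close> at indices \<open>\<ge> n\<close> are never looked at.
\<close>

type_synonym array = "nat \<Rightarrow> nat \<Rightarrow> int option"

definition row_entries :: "nat \<Rightarrow> array \<Rightarrow> nat \<Rightarrow> int list" where
  "row_entries n A r = map (\<lambda>c. the (A r c)) (filter (\<lambda>c. A r c \<noteq> None) [0..<n])"

definition col_entries :: "nat \<Rightarrow> array \<Rightarrow> nat \<Rightarrow> int list" where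
  "col_entries n A c = map (\<lambda>r. the (A r c)) (filter (\<lambda>r. A r c \<noteq> None) [0..<n])"

text \<open>
  In the last clause the inclusive ``or'' is meant; as there are exactly \<open>n * k\<close>
  filled cells, it already forces exactly one of \<open>x\<close>, \<open>-x\<close> to appear, exactly once.
\<close>

definition heffter_array :: "nat \<Rightarrow> nat \<Rightarrow> array \<Rightarrow> bool" where
  "heffter_array n k A \<longleftrightarrow>
     (\<forall>r<n. card {c. c < n \<and> A r c \<noteq> None} = k) \<and>
     (\<forall>c<n. card {r. r < n \<and> A r c \<noteq> None} = k) \<and>
     (\<forall>r<n. [sum_list (row_entries n A r) = 0] (mod (2 * int n * int k + 1))) \<and>
     (\<forall>c<n. [sum_list (col_entries n A c) = 0] (mod (2 * int n * int k + 1))) \<and>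
     (\<forall>x::int. 1 \<le> x \<and> x \<le> int n * int k \<longrightarrow>
        (\<exists>r<n. \<exists>c<n. A r c = Some x \<or> A r c = Some (- x)))"

definition integer_heffter_array :: "nat \<Rightarrow> nat \<Rightarrow> array \<Rightarrow> bool" where
  "integer_heffter_array n k A \<longleftrightarrow>
     heffter_array n k A \<and>
     (\<forall>r<n. sum_list (row_entries n A r) = 0) \<and>
     (\<forall>c<n. sum_list (col_entries n A c) = 0)"

definition simple_list :: "int \<Rightarrow> int list \<Rightarrow> bool" where
  "simple_list m as \<longleftrightarrow>
     (\<forall>i<length as. \<forall>i'<length as. i \<noteq> i' \<longrightarrow>
        \<not> [(\<Sum>j=0..i. as ! j) = (\<Sum>j=0..i'. as ! j)] (mod m))"

definition globally_simple :: "nat \<Rightarrow> nat \<Rightarrow> array \<Rightarrow> bool" where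
  "globally_simple n k A \<longleftrightarrow>
     (\<forall>r<n. simple_list (2 * int n * int k + 1) (row_entries n A r)) \<and>
     (\<forall>c<n. simple_list (2 * int n * int k + 1) (col_entries n A c))"

end

theory Submission
  imports Defs
begin

text \<open>
  Write \<open>n = 4 m + 1\<close>. All cells lie on cyclic diagonals, so the natural order of a row (column) is,
  up to rotation (and reversal), the order of the diagonals; as the line sums vanish, neither
  operation affects simplicity.

  Three diagonals carry the numbers \<open>1, \<dots>, 3 n\<close>: a zigzag sequence yields entries \<open>b < 0\<close> and
  \<open>- a - b > 0\<close> on two adjacent diagonals with absolute values in \<open>{n + 1, \<dots>, 3 n}\<close>, and an entry
  \<open>a\<close> with \<open>1 \<le> \<bar>a\<bar> \<le> n\<close> on the diagonal opposite to them. The remaining diagonals come in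
  adjacent pairs: \<open>p\<close> pairs of sum \<open>J\<close> between the two adjacent diagonals and the opposite one, and
  \<open>p\<close> pairs of sum \<open>- J\<close> after it. Here \<open>J = 2 n\<close> in every row, while \<open>J\<close> is \<open>2 n - 1\<close>, or
  \<open>3 n - 1\<close> for column \<open>0\<close>, in the columns. The partial sums then are \<open>b\<close>, the numbers \<open>j J\<close> and
  \<open>j J - a\<close> with \<open>j \<le> p\<close> (distinct because \<open>0 < \<bar>a\<bar> < J\<close>), and the values in the middle of the
  pairs, which are smaller than \<open>b\<close> for the first \<open>p\<close> pairs and larger than all the others for the
  last \<open>p\<close>. They span less than the modulus.
\<close>

section \<open>Simple lists\<close>

lemma sum_nth_eq_sum_list_take:
  fixes xs :: "'a::comm_monoid_add list"
  assumes "i < length xs"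
  shows "(\<Sum>j=0..i. xs ! j) = sum_list (take (Suc i) xs)"
proof -
  have "sum_list (take (Suc i) xs) = (\<Sum>j<Suc i. take (Suc i) xs ! j)"
    using assms by (simp add: sum_list_sum_nth atLeast0LessThan min_absorb2 del: sum.lessThan_Suc)
  also have "\<dots> = (\<Sum>j=0..i. xs ! j)"
    by (intro sum.cong) auto
  finally show ?thesis ..
qed

text \<open>Two partial sums agree exactly if the block between them sums to 0. \<open>ys\<close> is
  nonempty because even the first partial sum contains the first entry; so prefixes, in particular
  the whole list, may sum to 0.\<close>

lemma simple_list_iff_segment:
  "simple_list m xs \<longleftrightarrow>
     (\<forall>ys zs ws. xs = ys @ zs @ ws \<longrightarrow> ys \<noteq> [] \<longrightarrow> zs \<noteq> [] \<longrightarrow> \<not> [sum_list zs = 0] (mod m))"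
  (is "_ \<longleftrightarrow> ?R")
proof
  assume s: "simple_list m xs"
  show ?R
  proof (intro allI impI)
    fix ys zs ws assume xs: "xs = ys @ zs @ ws" and ne: "ys \<noteq> []" "zs \<noteq> []"
    define i where "i = length ys - 1"
    define i' where "i' = length ys + length zs - 1"
    have i: "Suc i = length ys" and i': "Suc i' = length ys + length zs"
      using ne by (auto simp: i_def i'_def Suc_diff_1)
    have l: "i < length xs" "i' < length xs" "i \<noteq> i'"
      using i i' xs ne by (simp_all flip: length_greater_0_conv)
    have "(\<Sum>j=0..i. xs ! j) = sum_list ys" "(\<Sum>j=0..i'. xs ! j) = sum_list ys + sum_list zs"
      using l by (simp_all add: sum_nth_eq_sum_list_take i i' xs)
    with s[unfolded simple_list_def, rule_format, OF l]
    have "\<not> [sum_list ys = sum_list ys + sum_list zs] (mod m)"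
      by simp
    then show "\<not> [sum_list zs = 0] (mod m)"
      by (simp add: cong_iff_dvd_diff)
  qed
next
  assume r: ?R
  have *: "\<not> [(\<Sum>j=0..i. xs ! j) = (\<Sum>j=0..i'. xs ! j)] (mod m)"
    if "i < i'" "i' < length xs" for i i'
  proof -
    define zs where "zs = take (i' - i) (drop (Suc i) xs)"
    have t: "take (Suc i') xs = take (Suc i) xs @ zs"
      using that take_add[of "Suc i" "i' - i" xs] by (simp add: zs_def)
    have "xs = take (Suc i) xs @ zs @ drop (Suc i') xs"
      using append_take_drop_id[of "Suc i'" xs] by (simp add: t del: append_take_drop_id)
    moreover have "take (Suc i) xs \<noteq> []" "zs \<noteq> []"
      using that by (auto simp: zs_def)
    ultimately have "\<not> [sum_list zs = 0] (mod m)"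
      using r by blast
    then show ?thesis
      using that by (auto simp: sum_nth_eq_sum_list_take t cong_iff_dvd_diff)
  qed
  then show "simple_list m xs"
    unfolding simple_list_def by (metis cong_sym nat_neq_iff)
qed

text \<open>A block ending the reversed list is a prefix of \<open>xs\<close>, about which
  simplicity says nothing. As the total vanishes, the complement of such a block sums to 0 as well,
  and this complement is no prefix of \<open>xs\<close>.\<close>

lemma simple_list_rev:
  assumes s: "simple_list m xs" and z: "[sum_list xs = 0] (mod m)"
  shows "simple_list m (rev xs)"
  unfolding simple_list_iff_segment
proof (intro allI impI notI)
  fix ys zs ws
  assume e: "rev xs = ys @ zs @ ws" and ne: "ys \<noteq> []" "zs \<noteq> []" and c: "[sum_list zs = 0] (mod m)"
  have xs: "xs = rev ws @ rev zs @ rev ys"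
    using e by (metis append.assoc rev_append rev_rev_ident)
  show False
  proof (cases "ws = []")
    case True
    have "[sum_list zs + sum_list ys = 0] (mod m)"
      using z by (simp add: xs True sum_list_rev)
    with c have "[sum_list (rev ys) = 0] (mod m)"
      by (simp add: cong_iff_dvd_diff dvd_add_right_iff sum_list_rev)
    then show False
      using s[unfolded simple_list_iff_segment, rule_format, of "rev zs" "rev ys" "[]"] xs True ne
      by simp
  next
    case False
    then show False
      using s[unfolded simple_list_iff_segment, rule_format, of "rev ws" "rev zs" "rev ys"] xs ne c
      by (simp add: sum_list_rev)
  qed
qed

text \<open>Only a block containing the moved entry \<open>x\<close> is new. It ends the rotated
  list, and its complement \<open>ys\<close>, which follows \<open>x\<close> in \<open>xs\<close>,
  would also sum to 0.\<close>

lemma simple_list_rotate1: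
  assumes s: "simple_list m xs" and z: "[sum_list xs = 0] (mod m)"
  shows "simple_list m (rotate1 xs)"
proof (cases xs)
  case (Cons x xs')
  show ?thesis
    unfolding simple_list_iff_segment
  proof (intro allI impI notI)
    fix ys zs ws
    assume e: "rotate1 xs = ys @ zs @ ws" and ne: "ys \<noteq> []" "zs \<noteq> []" and c: "[sum_list zs = 0] (mod m)"
    show False
    proof (cases ws rule: rev_cases)
      case Nil
      obtain zs' where zs: "zs = zs' @ [x]" "xs' = ys @ zs'"
        using e ne Cons Nil by (cases zs rule: rev_cases) auto
      have "[sum_list zs + sum_list ys = 0] (mod m)"
        using z by (simp add: Cons zs algebra_simps)
      with c have "[sum_list ys = 0] (mod m)"
        by (simp add: cong_iff_dvd_diff dvd_add_right_iff)
      then show False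
        using s[unfolded simple_list_iff_segment, rule_format, of "[x]" ys zs'] ne by (simp add: Cons zs)
    next
      case (snoc ws' w)
      then have "xs' = ys @ zs @ ws'"
        using e Cons by simp
      then show False
        using s[unfolded simple_list_iff_segment, rule_format, of "x # ys" zs ws'] ne c by (simp add: Cons)
    qed
  qed
qed (use s in simp)

lemma sum_list_rotate1: "sum_list (rotate1 xs) = sum_list (xs :: 'a::comm_monoid_add list)"
  by (cases xs) (auto simp: add.commute)

lemma sum_list_rotate: "sum_list (rotate t xs) = sum_list (xs :: 'a::comm_monoid_add list)"
  by (induction t) (auto simp: rotate_Suc sum_list_rotate1)

lemma simple_list_rotate:
  assumes "simple_list m xs" "[sum_list xs = 0] (mod m)"
  shows "simple_list m (rotate t xs)"
  using assms by (induction t) (auto simp: rotate_Suc simple_list_rotate1 sum_list_rotate)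

section \<open>Rotations and partial sums of the filled entries of a line\<close>

lemma map_filter_append: "List.map_filter f (xs @ ys) = List.map_filter f xs @ List.map_filter f ys"
  by (simp add: List.map_filter_def)

lemma map_filter_rotate: "\<exists>t'. rotate t' (List.map_filter f (rotate t xs)) = List.map_filter f xs"
proof -
  let ?k = "t mod length xs"
  have "rotate t xs = drop ?k xs @ take ?k xs"
    by (rule rotate_drop_take)
  then have "rotate (length (List.map_filter f (drop ?k xs))) (List.map_filter f (rotate t xs))
      = List.map_filter f (take ?k xs @ drop ?k xs)"
    by (simp only: map_filter_append rotate_append)
  then show ?thesis
    by (metis append_take_drop_id)
qed

lemma rotate_upt: "rotate t [0..<n] = map (\<lambda>d. (t + d) mod n) [0..<n]"
  by (rule nth_equalityI) (auto simp: nth_rotate)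

lemma map_filter_cong_upt:
  assumes "\<And>d. d < n \<Longrightarrow> f (s d) = g d"
  shows "List.map_filter f (map s [0..<n]) = List.map_filter g [0..<n]"
  using assms by (auto simp: List.map_filter_def filter_map o_def intro!: map_cong filter_cong)

lemma sum_list_map_filter_upt:
  assumes "\<And>d. d < n \<Longrightarrow> f d = None \<Longrightarrow> v d = 0" "\<And>d. d < n \<Longrightarrow> f d \<noteq> None \<Longrightarrow> f d = Some (v d)"
  shows "sum_list (List.map_filter f [0..<n]) = (\<Sum>d<n. v d :: 'a::comm_monoid_add)"
  using assms
proof (induction n)
  case (Suc n)
  then have "sum_list (List.map_filter f [0..<n]) = (\<Sum>d<n. v d)"
    by simp
  then show ?case
    using Suc.prems(1)[of n] Suc.prems(2)[of n] by (cases "f n") (auto simp: List.map_filter_def)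
qed (simp add: List.map_filter_def)

text \<open>Empty positions count as 0, so partial sums can be indexed by positions in the line
  instead of indices in the compressed list.\<close>

lemma simple_list_map_filter_upt:
  assumes "\<And>d. d < n \<Longrightarrow> f d = None \<Longrightarrow> v d = 0" "\<And>d. d < n \<Longrightarrow> f d \<noteq> None \<Longrightarrow> f d = Some (v d)"
    and "\<And>d e. d < e \<Longrightarrow> e < n \<Longrightarrow> f d \<noteq> None \<Longrightarrow> f e \<noteq> None \<Longrightarrow>
           \<not> [(\<Sum>i\<le>d. v i) = (\<Sum>i\<le>e. v i)] (mod m)"
  shows "simple_list m (List.map_filter f [0..<n])"
proof -
  define ds where "ds = filter (\<lambda>d. f d \<noteq> None) [0..<n]"
  have mf: "List.map_filter f [0..<n] = map v ds"
    using assms(2) by (fastforce simp: List.map_filter_def ds_def intro!: map_cong)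
  have len: "length (List.map_filter f [0..<n]) = length ds"
    by (simp add: mf)
  have s: "sorted_wrt (<) ds"
    by (simp add: ds_def sorted_wrt_filter)
  have ps: "(\<Sum>j=0..i. map v ds ! j) = (\<Sum>e\<le>ds ! i. v e)" if i: "i < length ds" for i
  proof -
    have in_ds: "ds ! j < n \<and> f (ds ! j) \<noteq> None" if "j < length ds" for j
      using nth_mem[OF that] by (auto simp: ds_def)
    have mono: "ds ! j < ds ! j'" if "j < j'" "j' < length ds" for j j'
      using sorted_wrt_nth_less[OF s that] .
    have inj: "inj_on ((!) ds) {0..i}"
      by (rule inj_onI) (metis atLeastAtMost_iff i le_less_trans mono nat_neq_iff)
    have "(\<Sum>j=0..i. map v ds ! j) = (\<Sum>j=0..i. v (ds ! j))"
      using i by (intro sum.cong) auto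
    also have "\<dots> = sum v ((!) ds ` {0..i})"
      by (simp add: sum.reindex[OF inj])
    also have "\<dots> = (\<Sum>e\<le>ds ! i. v e)"
    proof (rule sum.mono_neutral_left)
      show "(!) ds ` {0..i} \<subseteq> {..ds ! i}"
        using i mono by (force simp: le_less)
      show "\<forall>e\<in>{..ds ! i} - (!) ds ` {0..i}. v e = 0"
      proof
        fix e assume e: "e \<in> {..ds ! i} - (!) ds ` {0..i}"
        then have en: "e < n" using in_ds[OF i] by auto
        have "f e = None"
        proof (rule ccontr)
          assume "f e \<noteq> None"
          then have "e \<in> set ds" using en by (auto simp: ds_def)
          then obtain j where j: "j < length ds" "ds ! j = e"
            by (auto simp: in_set_conv_nth)
          then have "\<not> j \<le> i" using e by auto
          then have "ds ! i < e" using mono[of i j] j by auto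
          then show False using e by auto
        qed
        then show "v e = 0" using assms(1) en by blast
      qed
    qed auto
    finally show ?thesis .
  qed
  have "\<not> [(\<Sum>j=0..i. map v ds ! j) = (\<Sum>j=0..i'. map v ds ! j)] (mod m)"
    if "i < i'" "i' < length ds" for i i'
  proof -
    have "ds ! i \<in> set ds" "ds ! i' \<in> set ds" "ds ! i < ds ! i'"
      using that sorted_wrt_nth_less[OF s that] by auto
    then show ?thesis
      using assms(3)[of "ds ! i" "ds ! i'"] that ps by (auto simp: ds_def)
  qed
  then show ?thesis
    unfolding simple_list_def mf length_map by (metis cong_sym nat_neq_iff)
qed

section \<open>The common shape of rows and columns\<close>

text \<open>
  Position \<open>d\<close> counts diagonals; in the application \<open>n = 2 * h + 1\<close>. A pair of the first kind is
  \<open>(- x j, x j + J)\<close>, one of the second kind \<open>(y j, - (y j + J))\<close>.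
\<close>

locale line_profile =
  fixes h p :: nat and a b J :: int and x y :: "nat \<Rightarrow> int"
  assumes p_pos: "0 < p" and h_even: "even h" and h_ge: "2 * p + 1 \<le> h"
    and a_nz: "a \<noteq> 0" and a_less: "\<bar>a\<bar> < J"
    and b_neg: "b < 0" and ab_neg: "a + b < 0" and x_0: "- a - b < x 0" and y_0: "\<bar>a\<bar> < y 0"
    and x_step: "\<And>j. Suc j < p \<Longrightarrow> x j + J < x (Suc j)"
    and y_step: "\<And>j. Suc j < p \<Longrightarrow> y j + J < y (Suc j)"
begin

text \<open>Position \<open>h + 1\<close> is the diagonal opposite to 0 and 1. As \<open>h\<close>
  is even, the first member of a pair has an even position in both groups.\<close>

definition entry :: "nat \<Rightarrow> int option" where
  "entry d =
    (if d = 0 then Some b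
     else if d = 1 then Some (- a - b)
     else if d < 2 * p + 2 then
       Some (if even d then - x (d div 2 - 1) else x (d div 2 - 1) + J)
     else if d \<le> h then None
     else if d = h + 1 then Some a
     else if d \<le> h + 2 * p + 1 then
       Some (if even d then y ((d - h) div 2 - 1) else - (y ((d - h) div 2 - 1) + J))
     else None)"

definition val :: "nat \<Rightarrow> int" where
  "val d = (case entry d of None \<Rightarrow> 0 | Some z \<Rightarrow> z)"

text \<open>The partial sums in closed form, constant across empty positions; the final 0 is the
  line sum.\<close>

definition psum :: "nat \<Rightarrow> int" where
  "psum d =
    (if d = 0 then b
     else if d < 2 * p + 2 then
       (if even d then int (d div 2 - 1) * J - a - x (d div 2 - 1) else int (d div 2) * J - a)
     else if d \<le> h then int p * J - a
     else if d \<le> h + 2 * p + 1 then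
       (if odd d then (int p - int ((d - h) div 2)) * J
        else (int p - int ((d - h) div 2 - 1)) * J + y ((d - h) div 2 - 1))
     else 0)"

lemma psum_Suc: "psum (Suc d) = psum d + val (Suc d)"
proof -
  obtain g where g: "h = 2 * g" using h_even by blast
  have gp: "p < g" using h_ge g by simp
  consider j where "d = 2 * j" | j where "d = 2 * j + 1"
    by (metis evenE oddE)
  then show ?thesis
  proof cases
    case 1
    consider "j = 0" | "1 \<le> j" "j \<le> p" | "p < j" "j < g" | "j = g" | "g < j" "j \<le> g + p" | "g + p < j"
      by linarith
    then show ?thesis
    proof cases
      case 5
      \<comment> \<open>This form removes the truncated subtraction in the pair number.\<close>
      then obtain i where "j = g + Suc i" by (metis less_imp_Suc_add add_Suc_right)
      with 1 5 gp show ?thesis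
        unfolding psum_def val_def entry_def by (simp add: g algebra_simps)
    next
      case 2
      then obtain i where "j = Suc i" by (cases j) auto
      with 1 2 gp show ?thesis
        unfolding psum_def val_def entry_def by (simp add: g algebra_simps)
    qed (unfold psum_def val_def entry_def, use 1 gp in \<open>simp_all add: g algebra_simps\<close>)
  next
    case 2
    consider "j < p" | "j = p" | "p < j" "j < g" | "g \<le> j" "j < g + p" | "j = g + p" | "g + p < j"
      by linarith
    then show ?thesis
    proof cases
      case 4
      then obtain i where "j = g + i" by (metis le_iff_add)
      with 2 4 gp show ?thesis
        unfolding psum_def val_def entry_def by (simp add: g algebra_simps)
    qed (unfold psum_def val_def entry_def, use 2 gp in \<open>simp_all add: g algebra_simps\<close>)
  qed
qed

lemma sum_val: "(\<Sum>i\<le>d. val i) = psum d"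
  by (induction d) (simp_all add: psum_Suc, simp add: psum_def val_def entry_def)

section \<open>Distinctness and range of the partial sums\<close>

lemma J_pos: "0 < J"
  using a_less by linarith

text \<open>Used for both \<open>x\<close> and \<open>y\<close>: \<open>z j - int j * J\<close>
  increases strictly, which orders the partial sums reached in the middle of the pairs.\<close>

lemma step_mono:
  assumes z: "\<And>j. Suc j < p \<Longrightarrow> z j + J < z (Suc j)" and "j < k" "k < p"
  shows "z j + int (k - j) * J < (z k :: int)"
  using assms(2,3)
proof (induction k)
  case (Suc k)
  show ?case
  proof (cases "j = k")
    case False
    then have "z j + int (k - j) * J < z k" using Suc by simp
    moreover have "int (Suc k - j) * J = int (k - j) * J + J"
      using Suc False by (simp add: Suc_diff_le algebra_simps)
    ultimately show ?thesis using z[of k] Suc by simp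
  qed (use z[of k] Suc in simp)
qed simp

lemma step_mono_le:
  assumes z: "\<And>j. Suc j < p \<Longrightarrow> z j + J < z (Suc j)" and "j \<le> k" "k < p"
  shows "z j - int j * J \<le> (z k :: int) - int k * J"
  using step_mono[where z=z and j=j and k=k, OF z] assms(2,3)
  by (cases "j = k") (auto simp: of_nat_diff algebra_simps)

lemma step_inj:
  assumes z: "\<And>j. Suc j < p \<Longrightarrow> z j + J < z (Suc j)"
    and "j < p" "k < p" and eq: "z j - int j * J = (z k :: int) - int k * J"
  shows "j = k"
  using step_mono[where z=z and j=j and k=k, OF z] step_mono[where z=z and j=k and k=j, OF z] assms(2-)
  by (cases j k rule: linorder_cases) (auto simp: of_nat_diff algebra_simps)

lemma filled_cases:
  assumes "entry d \<noteq> None"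
  obtains "d = 0" "psum d = b"
  | j where "j < p" "d = 2 * j + 2" "psum d = int j * J - a - x j"
  | j where "j \<le> p" "d = 2 * j + 1" "psum d = int j * J - a"
  | j where "j \<le> p" "d = h + 2 * j + 1" "psum d = int (p - j) * J"
  | j where "j < p" "d = h + 2 * j + 2" "psum d = int (p - j) * J + y j"
proof -
  obtain g where g: "h = 2 * g" using h_even by blast
  have gp: "p < g" using h_ge g by simp
  have d: "d < 2 * p + 2 \<or> h < d \<and> d \<le> h + 2 * p + 1"
    using assms by (auto simp: entry_def split: if_splits)
  consider j where "d = 2 * j" | j where "d = 2 * j + 1"
    by (metis evenE oddE)
  then show ?thesis
  proof cases
    case 1
    consider "j = 0" | i where "j = Suc i" "i < p" | i where "j = g + Suc i" "i < p"
    proof -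
      consider "j = 0" | "0 < j" "j \<le> p" | "g < j" "j \<le> g + p" using d 1 g by fastforce
      then show ?thesis
      proof cases
        case 2 then show ?thesis using that(2)[of "j - 1"] by simp
      next
        case 3 then show ?thesis using that(3)[of "j - g - 1"] by simp
      qed (use that(1) in simp)
    qed
    then show ?thesis
    proof cases
      case 11: 1
      then show ?thesis using that(1) 1 by (simp add: psum_def)
    next
      case 2
      then show ?thesis using that(2)[of i] 1 by (simp add: psum_def)
    next
      case 3
      have "psum d = int (p - i) * J + y i"
        unfolding psum_def using 3 1 gp by (simp add: g of_nat_diff)
      then show ?thesis using that(5)[of i] 3 1 by (simp add: g)
    qed
  next
    case 2
    consider "j \<le> p" | i where "j = g + i" "i \<le> p"
    proof -
      consider "j \<le> p" | "g \<le> j" "j \<le> g + p" using d 2 g by fastforce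
      then show ?thesis
      proof cases
        case 2 then show ?thesis using that(2)[of "j - g"] by simp
      qed (use that(1) in simp)
    qed
    then show ?thesis
    proof cases
      case 1
      then show ?thesis using that(3)[of j] 2 by (simp add: psum_def)
    next
      case 22: 2
      have "psum d = int (p - i) * J"
        unfolding psum_def using 22 2 gp by (simp add: g of_nat_diff)
      then show ?thesis using that(4)[of i] 22 2 by (simp add: g)
    qed
  qed
qed

lemma mult_J_bounds:
  assumes "j \<le> p"
  shows "0 \<le> int j * J" "int j * J \<le> int p * J"
  using assms J_pos by (auto intro: mult_right_mono)

lemma mult_J_diff_eq: "j \<le> p \<Longrightarrow> int (p - j) * J = int p * J - int j * J"
  by (simp add: of_nat_diff left_diff_distrib)

text \<open>From \<open>0 < \<bar>a\<bar> < J\<close> it follows that \<open>J\<close> does not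
  divide \<open>a\<close>. This separates the sums at odd positions of the two groups, whose ranges
  overlap.\<close>

lemma not_mult_J: "int i * J - a \<noteq> int j * J"
proof
  assume "int i * J - a = int j * J"
  then have "a = (int i - int j) * J" by (simp add: algebra_simps)
  then have "J dvd a" by simp
  then show False using zdvd_imp_le[of J "\<bar>a\<bar>"] a_nz a_less by simp
qed

lemma x_ge: "j < p \<Longrightarrow> x 0 \<le> x j - int j * J"
  using step_mono_le[where z=x and j=0 and k=j, OF x_step] by simp

lemma y_ge: "j < p \<Longrightarrow> y 0 \<le> y j - int j * J"
  using step_mono_le[where z=y and j=0 and k=j, OF y_step] by simp

text \<open>The value alone locates a partial sum: middles of first pairs lie below \<open>b\<close>
  by \<open>x_0\<close>, middles of second pairs at or above \<open>int p * J + y 0\<close>, and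
  \<open>y_0\<close> keeps the sums at odd positions below that. Only the range between holds two
  families.\<close>

lemma filled_by_psum:
  assumes "entry d \<noteq> None"
  obtains j where "psum d < b" "j < p" "d = 2 * j + 2" "psum d = int j * J - a - x j"
  | "psum d = b" "d = 0"
  | j where "b < psum d" "psum d < int p * J + y 0" "j \<le> p" "d = 2 * j + 1" "psum d = int j * J - a"
  | j where "b < psum d" "psum d < int p * J + y 0" "j \<le> p" "d = h + 2 * j + 1" "psum d = int (p - j) * J"
  | j where "int p * J + y 0 \<le> psum d" "j < p" "d = h + 2 * j + 2" "psum d = int (p - j) * J + y j"
  using assms
proof (cases d rule: filled_cases)
  case (2 j)
  then show ?thesis using that(1)[of j] x_ge[of j] x_0 by linarith
next
  case (3 j)
  then show ?thesis using that(3)[of j] mult_J_bounds[of j] ab_neg y_0 by linarith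
next
  case (4 j)
  then show ?thesis using that(4)[of j] mult_J_bounds[of "p - j"] b_neg y_0 by linarith
next
  case (5 j)
  then show ?thesis using that(5)[of j] mult_J_diff_eq[of j] y_ge[of j] by linarith
qed (use that(2) in simp)

lemma psum_inj:
  assumes d: "entry d \<noteq> None" and e: "entry e \<noteq> None" and eq: "psum d = psum e"
  shows "d = e"
  using d
proof (cases d rule: filled_by_psum)
  case d: (1 j)
  from e d(1) eq show ?thesis
  proof (cases e rule: filled_by_psum)
    case (1 k)
    then show ?thesis using d eq step_inj[where z=x and j=j and k=k, OF x_step] by simp
  qed (use b_neg y_0 mult_J_bounds[of p] in linarith)+
next
  case d: 2
  from e d(1) eq show ?thesis
    by (cases e rule: filled_by_psum) (use d b_neg y_0 mult_J_bounds[of p] in linarith)+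
next
  case d: (3 j)
  from e d(1,2) eq show ?thesis
  proof (cases e rule: filled_by_psum)
    case (3 k)
    then show ?thesis using d eq J_pos by simp
  next
    case (4 k)
    then show ?thesis using d eq not_mult_J[of j "p - k"] by simp
  qed linarith+
next
  case d: (4 j)
  from e d(1,2) eq show ?thesis
  proof (cases e rule: filled_by_psum)
    case (3 k)
    then show ?thesis using d eq not_mult_J[of k "p - j"] by simp
  next
    case (4 k)
    then show ?thesis using d eq J_pos by simp
  qed linarith+
next
  case d: (5 j)
  from e d(1) eq show ?thesis
  proof (cases e rule: filled_by_psum)
    case (5 k)
    then have "y j - int j * J = y k - int k * J"
      using d eq mult_J_diff_eq[of j] mult_J_diff_eq[of k] by linarith
    then show ?thesis using 5 d step_inj[where z=y and j=j and k=k, OF y_step] by simp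
  qed (use b_neg y_0 mult_J_bounds[of p] in linarith)+
qed

text \<open>The extremes occur in the middle of the last pair of each kind, as
  \<open>x j - int j * J\<close> and \<open>y j - int j * J\<close> grow with
  \<open>j\<close>.\<close>

lemma psum_bounds:
  assumes "entry d \<noteq> None"
  shows "int (p - 1) * J - a - x (p - 1) \<le> psum d" "psum d \<le> J + y (p - 1)"
proof -
  have lo: "int (p - 1) * J - a - x (p - 1) \<le> int j * J - a - x j"
    and hi: "int (p - j) * J + y j \<le> J + y (p - 1)" if "j < p" for j
  proof -
    have j: "j \<le> p - 1" "p - 1 < p" using that by auto
    show "int (p - 1) * J - a - x (p - 1) \<le> int j * J - a - x j"
      using step_mono_le[where z=x, OF x_step j] by linarith
    have "int (p - 1) * J = int p * J - J" using p_pos mult_J_diff_eq[of 1] by simp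
    then show "int (p - j) * J + y j \<le> J + y (p - 1)"
      using step_mono_le[where z=y, OF y_step j] that mult_J_diff_eq[of j] by linarith
  qed
  have b: "int (p - 1) * J - a - x (p - 1) < b" and y0: "int p * J + y 0 \<le> J + y (p - 1)"
    using x_ge[of "p - 1"] x_0 hi[of 0] p_pos by simp_all
  have "int (p - 1) * J - a - x (p - 1) \<le> psum d \<and> psum d \<le> J + y (p - 1)"
    using assms
  proof (cases d rule: filled_by_psum)
    case (1 j)
    then show ?thesis using lo[of j] y0 b_neg y_0 mult_J_bounds[of p] by linarith
  next
    case 2
    then show ?thesis using b y0 b_neg y_0 mult_J_bounds[of p] by linarith
  next
    case (5 j)
    then show ?thesis using hi[of j] b b_neg y_0 mult_J_bounds[of p] by linarith
  qed (use b y0 in linarith)+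
  then show "int (p - 1) * J - a - x (p - 1) \<le> psum d" "psum d \<le> J + y (p - 1)"
    by auto
qed

text \<open>The left side of the assumption is the difference of the two bounds in
  \<open>psum_bounds\<close>; below \<open>M\<close>, distinct sums are incongruent.\<close>

lemma simple_list_entries:
  assumes "x (p - 1) + y (p - 1) + a + 2 * J - int p * J < M"
  shows "simple_list M (List.map_filter entry [0..<n])"
proof (rule simple_list_map_filter_upt)
  fix d e assume "d < e" and f: "entry d \<noteq> None" "entry e \<noteq> None"
  then have "psum d \<noteq> psum e" using psum_inj by blast
  moreover have "\<bar>psum d - psum e\<bar> < M"
    using psum_bounds[OF f(1)] psum_bounds[OF f(2)] assms mult_J_diff_eq[of 1] p_pos by (simp add: abs_less_iff)
  ultimately show "\<not> [(\<Sum>i\<le>d. val i) = (\<Sum>i\<le>e. val i)] (mod M)"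
    using zdvd_imp_le[of M "\<bar>psum d - psum e\<bar>"] by (auto simp: sum_val cong_iff_dvd_diff)
qed (auto simp: val_def)

lemma sum_list_entries: "sum_list (List.map_filter entry [0..<2 * h + 1]) = 0"
proof -
  have "sum_list (List.map_filter entry [0..<2 * h + 1]) = (\<Sum>d<2 * h + 1. val d)"
    by (rule sum_list_map_filter_upt) (auto simp: val_def)
  also have "\<dots> = psum (2 * h)"
    by (simp add: lessThan_Suc_atMost sum_val)
  \<comment> \<open>Since \<open>h\<close> is even, \<open>2 * p + 1 \<le> h\<close> is strict, so
    position \<open>2 * h\<close> lies beyond the last pair.\<close>
  also have "\<dots> = 0"
    using h_ge h_even by (auto simp: psum_def)
  finally show ?thesis .
qed

end

section \<open>Transfer of the profile to rotated and reversed lines\<close>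

lemma map_filter_rev: "List.map_filter f (rev xs) = rev (List.map_filter f xs)"
  by (simp add: List.map_filter_def rev_map rev_filter)

lemma card_eq_length_map_filter: "card {i. i < n \<and> f i \<noteq> None} = length (List.map_filter f [0..<n])"
  by (simp add: List.map_filter_def length_filter_conv_card cong: conj_cong)

context line_profile
begin

lemma length_entries: "length (List.map_filter entry [0..<2 * h + 1]) = 4 * p + 3"
proof -
  have "{d. d < 2 * h + 1 \<and> entry d \<noteq> None} = {..<2 * p + 2} \<union> {h + 1..h + 2 * p + 1}"
    using h_ge by (auto simp: entry_def)
  moreover have "card ({..<2 * p + 2} \<union> {h + 1..h + 2 * p + 1}) = 4 * p + 3"
    using h_ge by (subst card_Un_disjoint) auto
  ultimately show ?thesis
    unfolding card_eq_length_map_filter[symmetric] by simp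
qed

text \<open>The first alternative in \<open>f\<close> serves rows, the second columns: going down a
  column, the diagonal number decreases.\<close>

lemma line_properties:
  assumes n: "n = 2 * h + 1"
    and M: "x (p - 1) + y (p - 1) + a + 2 * J - int p * J < M"
    and f: "(\<forall>d<n. f ((t + d) mod n) = entry d) \<or> (\<forall>d<n. f ((t + d) mod n) = entry (n - 1 - d))"
  shows "card {i. i < n \<and> f i \<noteq> None} = 4 * p + 3"
    and "sum_list (List.map_filter f [0..<n]) = 0"
    and "simple_list M (List.map_filter f [0..<n])"
proof -
  define L where "L = List.map_filter entry [0..<n]"
  have L: "length L = 4 * p + 3" "sum_list L = 0" "simple_list M L"
    using length_entries sum_list_entries simple_list_entries[OF M] unfolding L_def n by blast+
  obtain t' where t': "List.map_filter f [0..<n] = rotate t' (List.map_filter f (rotate t [0..<n]))"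
    using map_filter_rotate by metis
  have "rev [0..<n] = map (\<lambda>d. n - 1 - d) [0..<n]"
    by (rule nth_equalityI) (auto simp: rev_nth)
  then have "rev L = List.map_filter (\<lambda>d. entry (n - 1 - d)) [0..<n]"
    unfolding L_def by (simp add: map_filter_rev[symmetric] map_filter_cong_upt)
  then have "List.map_filter f (rotate t [0..<n]) \<in> {L, rev L}"
    using f by (auto simp: rotate_upt L_def intro!: map_filter_cong_upt)
  then obtain L' where L': "L' \<in> {L, rev L}" "List.map_filter f [0..<n] = rotate t' L'"
    using t' by blast
  have "length L' = 4 * p + 3" "sum_list L' = 0" "simple_list M L'"
    using L' L by (auto simp: sum_list_rev simple_list_rev)
  then show "card {i. i < n \<and> f i \<noteq> None} = 4 * p + 3"
    and "sum_list (List.map_filter f [0..<n]) = 0"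
    and "simple_list M (List.map_filter f [0..<n])"
    unfolding card_eq_length_map_filter L'(2) by (simp_all add: sum_list_rotate simple_list_rotate)
qed

end

section \<open>The array\<close>

text \<open>
  With \<open>K = 16 m + 5 = 4 n + 1\<close>, the numbers \<open>u r = outer m r - K / 2\<close> listed along
  \<open>r = 0, 2 m, 4 m, \<dots>\<close> modulo \<open>n\<close> form a zigzag: their absolute values are
  \<open>1 / 2, 3 / 2, \<dots>, n - 1 / 2\<close>, and the absolute values of the sums of cyclically consecutive terms
  are \<open>1, \<dots>, n\<close>. Hence \<open>outer m r\<close> and \<open>K - outer m r\<close> together exhaust \<open>{n + 1, \<dots>, 3 n}\<close>.
\<close>

definition outer :: "nat \<Rightarrow> nat \<Rightarrow> int" where
  "outer m r =
    (if r = 0 then 8 * int m + 3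
     else if r \<le> m then 10 * int m + 3 + int r
     else if r \<le> 2 * m then 6 * int m + 2 - int r
     else if r \<le> 3 * m then 4 * int m + 1 + int r
     else 12 * int m + 4 - int r)"

text \<open>This is \<open>- (u r + u (r + 2 m))\<close> for the zigzag \<open>u\<close>; it makes
  the three special entries of row \<open>r\<close> cancel.\<close>

definition middle :: "nat \<Rightarrow> nat \<Rightarrow> int" where
  "middle m r = 16 * int m + 5 - outer m r - outer m ((r + 2 * m) mod (4 * m + 1))"

section \<open>Absolute values taken by \<open>outer\<close> and \<open>middle\<close>\<close>

lemma outer_bounds:
  assumes "r < 4 * m + 1"
  shows "4 * int m + 1 < outer m r" "outer m r \<le> 12 * int m + 3" "outer m r < 16 * int m + 5"
  using assms by (auto simp: outer_def)

text \<open>Beyond row \<open>2 m\<close> the partner \<open>r + 2 m\<close> wraps around to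
  \<open>r - 2 m - 1\<close>. Rows 0 and \<open>2 m + 1\<close> are exceptional because they or
  their partners are row 0; row \<open>3 m + 1\<close> because its partner \<open>m\<close> is still
  in the first nonzero branch of \<open>outer\<close>.\<close>

lemma middle_eq:
  assumes "r < 4 * m + 1" "0 < m"
  shows "middle m r =
    (if r = 0 then 4 * int m
     else if r \<le> m then 1 - 2 * int r
     else if r \<le> 2 * m then 2 * int r - 1
     else if r = 2 * m + 1 then 2 * int m
     else if r \<le> 3 * m then 4 * int m + 2 - 2 * int r
     else if r = 3 * m + 1 then - 4 * int m - 1
     else 2 * int r - 4 * int m - 2)"
proof (cases "r \<le> 2 * m")
  case True
  then show ?thesis
    using assms by (auto simp: middle_def outer_def)
next
  case False
  define s where "s = r - (2 * m + 1)"
  then have s: "r = 2 * m + 1 + s" "s < 2 * m"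
    using assms False by auto
  have "(r + 2 * m) mod (4 * m + 1) = (s + (4 * m + 1)) mod (4 * m + 1)"
    using s by (simp add: algebra_simps)
  also have "\<dots> = s"
    using s by (simp only: mod_add_self2) simp
  finally show ?thesis
    using s assms by (auto simp: middle_def outer_def)
qed

lemma middle_bounds:
  assumes "r < 4 * m + 1" "0 < m"
  shows "middle m r \<noteq> 0" "\<bar>middle m r\<bar> \<le> 4 * int m + 1"
  using assms by (auto simp: middle_eq)

lemma middle_surj:
  assumes "1 \<le> x" "x \<le> 4 * m + 1" "0 < m"
  shows "\<exists>r<4 * m + 1. \<bar>middle m r\<bar> = int x"
proof -
  \<comment> \<open>Odd absolute values come from rows \<open>1, ..., 2 m\<close> and
    \<open>3 m + 1\<close>, even ones from the remaining rows.\<close>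
  consider s where "x = 2 * s + 1" "s < 2 * m" | "x = 4 * m + 1" | "x = 2 * m" | "x = 4 * m"
    | s where "x = 2 * s" "0 < s" "s < 2 * m" "s \<noteq> m"
  proof (cases "even x")
    case True
    then obtain s where "x = 2 * s" by blast
    then show ?thesis using that(3,4) that(5)[of s] assms by fastforce
  next
    case False
    then obtain s where "x = 2 * s + 1" by (rule oddE)
    then show ?thesis using that(1)[of s] that(2) assms by fastforce
  qed
  then show ?thesis
  proof cases
    case (1 s)
    then show ?thesis using assms(3) by (intro exI[of _ "s + 1"]) (simp add: middle_eq)
  next
    case 2
    then show ?thesis using assms(3) by (intro exI[of _ "3 * m + 1"]) (simp add: middle_eq)
  next
    case 3
    then show ?thesis using assms(3) by (intro exI[of _ "2 * m + 1"]) (simp add: middle_eq)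
  next
    case 4
    then show ?thesis using assms(3) by (intro exI[of _ 0]) (simp add: middle_eq)
  next
    case (5 s)
    then show ?thesis using assms(3) by (intro exI[of _ "s + 2 * m + 1"]) (auto simp: middle_eq)
  qed
qed

lemma outer_surj:
  assumes "4 * int m + 1 < x" "x \<le> 12 * int m + 3" "0 < m"
  shows "\<exists>r<4 * m + 1. outer m r = x \<or> 16 * int m + 5 - outer m r = x"
proof -
  \<comment> \<open>These four intervals are the image of \<open>outer m\<close>;
    \<open>x \<mapsto> 16 m + 5 - x\<close> maps them onto the gaps between them and the interval
    above them. The witness inverts \<open>outer\<close> branch by branch.\<close>
  have *: "\<exists>r<4 * m + 1. outer m r = x"
    if "x \<le> 5 * int m + 1 \<and> 4 * int m + 1 < x \<or> 6 * int m + 2 \<le> x \<and> x \<le> 7 * int m + 1 \<or>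
      8 * int m + 3 \<le> x \<and> x \<le> 9 * int m + 3 \<or> 10 * int m + 4 \<le> x \<and> x \<le> 11 * int m + 3" for x
  proof -
    define r where "r = nat (if x \<le> 5 * int m + 1 then 6 * int m + 2 - x
      else if x \<le> 7 * int m + 1 then x - 4 * int m - 1
      else if x = 8 * int m + 3 then 0
      else if x \<le> 9 * int m + 3 then 12 * int m + 4 - x else x - 10 * int m - 3)"
    have "r < 4 * m + 1 \<and> outer m r = x"
      using that assms(3) by (auto simp: r_def outer_def nat_less_iff nat_le_iff split: if_splits)
    then show ?thesis by blast
  qed
  let ?P = "\<lambda>x. x \<le> 5 * int m + 1 \<and> 4 * int m + 1 < x \<or> 6 * int m + 2 \<le> x \<and> x \<le> 7 * int m + 1 \<or>
      8 * int m + 3 \<le> x \<and> x \<le> 9 * int m + 3 \<or> 10 * int m + 4 \<le> x \<and> x \<le> 11 * int m + 3"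
  have "?P x \<or> ?P (16 * int m + 5 - x)"
    using assms by linarith
  then show ?thesis
  proof
    assume "?P (16 * int m + 5 - x)"
    from *[OF this] obtain r where "r < 4 * m + 1" "outer m r = 16 * int m + 5 - x" by blast
    then have "r < 4 * m + 1 \<and> 16 * int m + 5 - outer m r = x" by linarith
    then show ?thesis by blast
  qed (use *[of x] in blast)
qed

text \<open>
  The cell \<open>(r, c)\<close> lies on the diagonal \<open>d = c - r + 1\<close> modulo \<open>n\<close>; \<open>n\<close> is added before
  subtracting to avoid truncation.
\<close>

definition heffter_cell :: "nat \<Rightarrow> nat \<Rightarrow> array" where
  "heffter_cell m p r c =
    (let n = 4 * m + 1; d = (c + 1 + n - r) mod n in
     if d = 0 then Some (outer m ((r + 2 * m) mod n) - (16 * int m + 5))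
     else if d = 1 then Some (outer m r)
     else if d < 2 * p + 2 then
       Some (if even d then - (3 * int n + 1 + 4 * int n * int (d div 2 - 1) + int c)
             else 5 * int n + 1 + 4 * int n * int (d div 2 - 1) + int ((c + n - 1) mod n))
     else if d \<le> 2 * m then None
     else if d = 2 * m + 1 then Some (middle m r)
     else if d \<le> 2 * m + 2 * p + 1 then
       Some (if even d then 4 * int n + 1 + 4 * int n * int ((d - 2 * m) div 2 - 1) + int c
             else - (6 * int n + 1 + 4 * int n * int ((d - 2 * m) div 2 - 1) + int ((c + n - 1) mod n)))
     else None)"

section \<open>Rows and columns as line profiles\<close>

context
  fixes m p n :: nat
  assumes p: "0 < p" and pm: "p < m" and n: "n = 4 * m + 1"
begin

text \<open>Row \<open>r\<close> meets diagonal \<open>d\<close> in column \<open>r + d - 1\<close>.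
  The second cell of a pair is one column further right but uses the preceding column index, so both
  members share this index and \<open>J\<close> is exactly \<open>2 n\<close>.\<close>

abbreviation row_x where "row_x r j \<equiv> 3 * int n + 1 + 4 * int n * int j + int ((r + (2 * j + 1)) mod n)"
abbreviation row_y where "row_y r j \<equiv> 4 * int n + 1 + 4 * int n * int j + int ((r + (2 * m + 2 * j + 1)) mod n)"
abbreviation row_b where "row_b r \<equiv> outer m ((r + 2 * m) mod n) - (16 * int m + 5)"

abbreviation col_x where "col_x c j \<equiv> 3 * int n + 1 + 4 * int n * int j + int c"
abbreviation col_y where "col_y c j \<equiv> 4 * int n + 1 + 4 * int n * int j + int c"
text \<open>Within a column the two members of a pair use \<open>c\<close> and its cyclic
  predecessor.\<close>

abbreviation col_J where "col_J c \<equiv> 2 * int n + int ((c + n - 1) mod n) - int c"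

lemma int_n: "int n = 4 * int m + 1" "8 < int n"
  using p pm by (auto simp: n)

lemma mod_n: "i mod n < n" "0 \<le> int (i mod n)" "int (i mod n) \<le> int n - 1"
proof -
  show "i mod n < n" by (simp add: n)
  then show "0 \<le> int (i mod n)" "int (i mod n) \<le> int n - 1" by linarith+
qed

lemma mult_Suc_j: "4 * int n * int (Suc j) = 4 * int n * int j + 4 * int n"
  by (simp add: algebra_simps)

lemma col_J_eq:
  assumes "c < n"
  shows "col_J c = (if c = 0 then 3 * int n - 1 else 2 * int n - 1)"
proof (cases c)
  case (Suc c')
  then have "(c + n - 1) mod n = (c' + n) mod n" by simp
  also have "\<dots> = c'" using assms Suc by (simp only: mod_add_self2) simp
  finally show ?thesis using Suc by simp
qed (simp add: n)

lemma row_profile: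
  assumes r: "r < n"
  shows "line_profile (2 * m) p (middle m r) (row_b r) (2 * int n) (row_x r) (row_y r)"
proof
  fix j
  show "row_x r j + 2 * int n < row_x r (Suc j)"
    using mod_n[of "r + (2 * j + 1)"] mod_n[of "r + (2 * Suc j + 1)"] int_n mult_Suc_j[of j] by linarith
  show "row_y r j + 2 * int n < row_y r (Suc j)"
    using mod_n[of "r + (2 * m + 2 * j + 1)"] mod_n[of "r + (2 * m + 2 * Suc j + 1)"] int_n mult_Suc_j[of j]
    by linarith
next
  have s: "middle m r + row_b r = - outer m r"
    by (simp add: middle_def n)
  show "middle m r + row_b r < 0" "- middle m r - row_b r < row_x r 0"
    using outer_bounds[of r m] r int_n s mod_n[of "r + (2 * 0 + 1)"] by (simp_all add: n[symmetric])
  show "row_b r < 0"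
    using outer_bounds(3)[of "(r + 2 * m) mod n" m, folded n, OF mod_n(1)] by simp
  show "middle m r \<noteq> 0" "\<bar>middle m r\<bar> < 2 * int n" "\<bar>middle m r\<bar> < row_y r 0"
    using middle_bounds[of r m, folded n, OF r] int_n p pm mod_n[of "r + (2 * m + 2 * 0 + 1)"] by auto
qed (use p pm in auto)

text \<open>Row \<open>c + 2 m + 1\<close> carries the opposite entry of column \<open>c\<close>.
  Its zigzag partner is \<open>c\<close>, so that entry involves \<open>outer m c\<close>, and the
  three special entries of the column cancel too.\<close>

lemma col_shift: "c < n \<Longrightarrow> ((c + 2 * m + 1) mod n + 2 * m) mod n = c"
proof -
  assume c: "c < n"
  have "((c + 2 * m + 1) mod n + 2 * m) mod n = (c + 2 * m + 1 + 2 * m) mod n"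
    by (rule mod_add_left_eq)
  also have "c + 2 * m + 1 + 2 * m = c + n" by (simp add: n)
  finally show ?thesis using c by simp
qed

lemma col_profile:
  assumes c: "c < n"
  shows "line_profile (2 * m) p (middle m ((c + 2 * m + 1) mod n)) (row_b (c + 1)) (col_J c) (col_x c) (col_y c)"
proof
  fix j
  show "col_x c j + col_J c < col_x c (Suc j)" "col_y c j + col_J c < col_y c (Suc j)"
    unfolding col_J_eq[OF c] using int_n mult_Suc_j[of j] by auto
next
  let ?a = "middle m ((c + 2 * m + 1) mod n)" and ?b = "row_b (c + 1)"
  have s: "?a + ?b = - outer m c"
    unfolding middle_def n[symmetric] col_shift[OF c] by (simp add: add_ac)
  show "?a + ?b < 0" "- ?a - ?b < col_x c 0"
    using outer_bounds[of c m] c int_n s by (simp_all add: n[symmetric])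
  show "?b < 0"
    using outer_bounds(3)[of "(c + 1 + 2 * m) mod n" m, folded n, OF mod_n(1)] by simp
  have "?a \<noteq> 0" "\<bar>?a\<bar> \<le> int n"
    using middle_bounds[of "(c + 2 * m + 1) mod n" m, folded n, OF mod_n(1)] p pm int_n by auto
  then show "?a \<noteq> 0" "\<bar>?a\<bar> < col_J c" "\<bar>?a\<bar> < col_y c 0"
    using int_n unfolding col_J_eq[OF c] by auto
qed (use p pm in auto)

lemma even_odd_cases:
  fixes d :: nat
  assumes "\<not> d < 2"
  obtains j where "d = 2 * j + 2" | j where "d = 2 * j + 3"
proof -
  have "d = 2 * ((d - 2) div 2) + 2 \<or> d = 2 * ((d - 2) div 2) + 3"
    using assms by presburger
  then show ?thesis using that by blast
qed

lemma row_cell: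
  assumes r: "r < n" and d: "d < n"
  shows "heffter_cell m p r ((r + n - 1 + d) mod n) =
    line_profile.entry (2 * m) p (middle m r) (row_b r) (2 * int n) (row_x r) (row_y r) d"
proof -
  interpret line_profile "2 * m" p "middle m r" "row_b r" "2 * int n" "row_x r" "row_y r"
    by (rule row_profile[OF r])
  let ?c = "(r + n - 1 + d) mod n"
  have n0: "0 < n" by (simp add: n)
  have "?c + 1 + n - r = ?c + (1 + n - r)" using r by simp
  then have "(?c + 1 + n - r) mod n = ((r + n - 1 + d) + (1 + n - r)) mod n"
    by (simp only: mod_add_left_eq)
  also have "(r + n - 1 + d) + (1 + n - r) = d + n + n" using r by simp
  finally have d': "(?c + 1 + n - r) mod n = d"
    using d by (simp only: mod_add_self2) simp
  have ev: "?c = (r + (2 * j + 1)) mod n" if "d = 2 * j + 2" for j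
  proof -
    have "r + n - 1 + d = r + (2 * j + 1) + n" using that n0 by simp
    then show ?thesis by (simp only: mod_add_self2)
  qed
  have od: "(?c + n - 1) mod n = (r + (2 * j + 1)) mod n" if "d = 2 * j + 3" for j
  proof -
    have "?c + n - 1 = ?c + (n - 1)" using n0 by simp
    then have "(?c + n - 1) mod n = (r + n - 1 + d + (n - 1)) mod n" by (simp only: mod_add_left_eq)
    also have "r + n - 1 + d + (n - 1) = r + (2 * j + 1) + n + n" using that n0 by simp
    finally show ?thesis by (simp only: mod_add_self2)
  qed
  show ?thesis
  proof (cases "d < 2")
    case True
    then show ?thesis
      unfolding heffter_cell_def Let_def n[symmetric] d' entry_def
      by (auto simp: middle_def n)
  next
    case False
    then show ?thesis
    proof (cases d rule: even_odd_cases)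
      case (1 j)
      have e: "even d" "d \<noteq> 0" "d \<noteq> 1" "d \<noteq> 2 * m + 1" "d div 2 - 1 = j"
        using 1 by presburger+
      \<comment> \<open>Here \<open>j\<close> counts pairs from diagonal 0, whereas
        \<open>row_y\<close> counts them from diagonal \<open>2 m\<close>.\<close>
      have q: "2 * m + 2 * ((d - 2 * m) div 2 - 1) + 1 = 2 * j + 1" if "\<not> d \<le> 2 * m"
        using 1 that by presburger
      show ?thesis
        unfolding heffter_cell_def Let_def n[symmetric] d' unfolding entry_def ev[OF 1] e(5)
        using e(1-4) q by simp
    next
      case (2 j)
      have e: "odd d" "d \<noteq> 0" "d \<noteq> 1" "d div 2 - 1 = j"
        using 2 by presburger+
      have q: "2 * m + 2 * ((d - 2 * m) div 2 - 1) + 1 = 2 * j + 1" if "\<not> d \<le> 2 * m" "d \<noteq> 2 * m + 1"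
        using 2 that by presburger
      show ?thesis
        unfolding heffter_cell_def Let_def n[symmetric] d' unfolding entry_def od[OF 2] e(4)
        using e(1-3) q by simp
    qed
  qed
qed


lemma col_cell:
  assumes c: "c < n" and d: "d < n"
  shows "heffter_cell m p ((c + 1 + n - d) mod n) c =
    line_profile.entry (2 * m) p (middle m ((c + 2 * m + 1) mod n)) (row_b (c + 1)) (col_J c) (col_x c) (col_y c) d"
proof -
  interpret line_profile "2 * m" p "middle m ((c + 2 * m + 1) mod n)" "row_b (c + 1)" "col_J c" "col_x c" "col_y c"
    by (rule col_profile[OF c])
  have d': "(c + 1 + n - (c + 1 + n - d) mod n) mod n = d"
  proof -
    \<comment> \<open>The cases are that \<open>c + 1 + n - d\<close> wraps around zero times, once
      or twice.\<close>
    consider "c + 1 < d" | "d \<le> c + 1" "c + 1 < d + n" | "c + 1 = n" "d = 0"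
      using c by linarith
    then show ?thesis
    proof cases
      case 2
      then have "(c + 1 + n - d) mod n = (c + 1 - d + n) mod n" by simp
      also have "\<dots> = c + 1 - d" using 2 by (simp only: mod_add_self2) simp
      finally have "c + 1 + n - (c + 1 + n - d) mod n = d + n" using 2 by simp
      then show ?thesis using d by simp
    qed (use d in auto)
  qed
  have b: "((c + 1 + n) mod n + 2 * m) mod n = (c + 1 + 2 * m) mod n"
    by (simp add: mod_simps) (metis add.commute add.left_commute add_Suc mod_add_self2)
  have oc: "outer m c = - middle m ((c + 2 * m + 1) mod n) - row_b (c + 1)"
    unfolding middle_def n[symmetric] col_shift[OF c] by (simp add: add_ac)
  have a: "c + 1 + n - (2 * m + 1) = c + 2 * m + 1"
    by (simp add: n)
  consider "d = 0" | "d = 1" | "d = 2 * m + 1" | "d \<noteq> 0" "d \<noteq> 1" "d \<noteq> 2 * m + 1" by blast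
  then show ?thesis
  proof cases
    case 1
    show ?thesis
      unfolding heffter_cell_def Let_def n[symmetric] d' unfolding entry_def 1 using b by simp
  next
    case 2
    show ?thesis
      unfolding heffter_cell_def Let_def n[symmetric] d' unfolding entry_def 2 using c oc by simp
  next
    case 3
    show ?thesis
      unfolding heffter_cell_def Let_def n[symmetric] d' unfolding entry_def 3 a using p pm by simp
  next
    case 4
    show ?thesis
      unfolding heffter_cell_def Let_def n[symmetric] d' unfolding entry_def using 4 by simp
  qed
qed

lemma mult_p_pred: "4 * int n * int (p - 1) = 4 * int n * int p - 4 * int n"
  using p by (simp add: algebra_simps of_nat_diff)

lemma row_line:
  assumes r: "r < n"
  shows "card {c. c < n \<and> heffter_cell m p r c \<noteq> None} = 4 * p + 3"
    and "sum_list (List.map_filter (heffter_cell m p r) [0..<n]) = 0"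
    and "simple_list (2 * int n * int (4 * p + 3) + 1) (List.map_filter (heffter_cell m p r) [0..<n])"
proof -
  interpret line_profile "2 * m" p "middle m r" "row_b r" "2 * int n" "row_x r" "row_y r"
    by (rule row_profile[OF r])
  have "int n * 1 \<le> int n * int p"
    using p by (intro mult_left_mono) auto
  \<comment> \<open>The span is at most \<open>8 n p + 4 n\<close>, while the modulus is
    \<open>8 n p + 6 n + 1\<close>.\<close>
  then have w: "row_x r (p - 1) + row_y r (p - 1) + middle m r + 2 * (2 * int n) - int p * (2 * int n)
      < 2 * int n * int (4 * p + 3) + 1"
    using mod_n[of "r + (2 * (p - 1) + 1)"] mod_n[of "r + (2 * m + 2 * (p - 1) + 1)"]
      middle_bounds[of r m] r n p pm mult_p_pred
    by (simp add: algebra_simps)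
  have n': "n = 2 * (2 * m) + 1" by (simp add: n)
  have "\<forall>d<n. heffter_cell m p r ((r + n - 1 + d) mod n) = entry d"
    using row_cell[OF r] by blast
  note * = line_properties[OF n' w disjI1[OF this]]
  show "card {c. c < n \<and> heffter_cell m p r c \<noteq> None} = 4 * p + 3"
    and "sum_list (List.map_filter (heffter_cell m p r) [0..<n]) = 0"
    and "simple_list (2 * int n * int (4 * p + 3) + 1) (List.map_filter (heffter_cell m p r) [0..<n])"
    by (fact *)+
qed

lemma col_line:
  assumes c: "c < n"
  shows "card {r. r < n \<and> heffter_cell m p r c \<noteq> None} = 4 * p + 3"
    and "sum_list (List.map_filter (\<lambda>r. heffter_cell m p r c) [0..<n]) = 0"
    and "simple_list (2 * int n * int (4 * p + 3) + 1) (List.map_filter (\<lambda>r. heffter_cell m p r c) [0..<n])"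
proof -
  let ?a = "middle m ((c + 2 * m + 1) mod n)"
  interpret line_profile "2 * m" p ?a "row_b (c + 1)" "col_J c" "col_x c" "col_y c"
    by (rule col_profile[OF c])
  have a: "?a \<le> int n"
    using middle_bounds[of "(c + 2 * m + 1) mod n" m, folded n, OF mod_n(1)] p pm n by simp
  have J: "0 < col_J c" "col_J c \<le> 3 * int n - 1"
    unfolding col_J_eq[OF c] using int_n by auto
  have pJ: "K \<le> int p * K" if "0 < K" for K :: int
    using mult_right_mono[of 1 "int p" K] p that by simp
  have M: "2 * int n * int (4 * p + 3) = 2 * (4 * int n * int p) + 6 * int n"
    by (simp add: algebra_simps)
  have c': "int c < int n" using c by simp
  \<comment> \<open>Products such as \<open>4 n p\<close> become variables, which leaves a linear
    inequality; \<open>K'\<close> stands for \<open>p J\<close>.\<close>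
  have "3 * N + 1 + P' + C + (4 * N + 1 + P' + C) + A + 2 * K - K' < R + 1"
    if "P' = P - 4 * N" "R = 2 * P + 6 * N" "0 \<le> C" "C < N" "A \<le> N" "K \<le> 3 * N - 1" "K \<le> K'"
    for N P P' C A K K' R :: int
    using that by linarith
  note w = this[OF mult_p_pred M of_nat_0_le_iff c' a J(2) pJ[OF J(1)]]
  have n': "n = 2 * (2 * m) + 1" by (simp add: n)
  have "\<forall>e<n. heffter_cell m p ((c + 2 + e) mod n) c = entry (n - 1 - e)"
  proof (intro allI impI)
    fix e assume "e < n"
    then have e: "n - 1 - e < n" "c + 1 + n - (n - 1 - e) = c + 2 + e" by simp_all
    from col_cell[OF c e(1)] show "heffter_cell m p ((c + 2 + e) mod n) c = entry (n - 1 - e)"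
      unfolding e(2) .
  qed
  note * = line_properties[where f = "\<lambda>r. heffter_cell m p r c", OF n' w disjI2[OF this]]
  show "card {r. r < n \<and> heffter_cell m p r c \<noteq> None} = 4 * p + 3"
    and "sum_list (List.map_filter (\<lambda>r. heffter_cell m p r c) [0..<n]) = 0"
    and "simple_list (2 * int n * int (4 * p + 3) + 1) (List.map_filter (\<lambda>r. heffter_cell m p r c) [0..<n])"
    by (fact *)+
qed

section \<open>Every absolute value occurs\<close>

abbreviation col_entry where
  "col_entry c \<equiv> line_profile.entry (2 * m) p (middle m ((c + 2 * m + 1) mod n)) (row_b (c + 1))
    (col_J c) (col_x c) (col_y c)"

lemma cell_in_column:
  assumes c: "c < n" and d: "d < n" and v: "col_entry c d = Some v" "\<bar>v\<bar> = x"
  shows "\<exists>r<n. \<exists>c<n. heffter_cell m p r c = Some x \<or> heffter_cell m p r c = Some (- x)"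
proof -
  have "(c + 1 + n - d) mod n < n" by (rule mod_n(1))
  moreover have "heffter_cell m p ((c + 1 + n - d) mod n) c = Some x \<or>
      heffter_cell m p ((c + 1 + n - d) mod n) c = Some (- x)"
    unfolding col_cell[OF c d] v(1) using v(2) by auto
  ultimately show ?thesis using c by blast
qed

lemma heffter_cell_surj:
  assumes x: "1 \<le> x" "x \<le> int n * int (4 * p + 3)"
  shows "\<exists>r<n. \<exists>c<n. heffter_cell m p r c = Some x \<or> heffter_cell m p r c = Some (- x)"
proof -
  have n0: "0 < n" by (simp add: n)
  note entry_def = line_profile.entry_def[OF col_profile]
  consider "x \<le> int n" | "int n < x" "x \<le> 3 * int n" | "3 * int n < x" by linarith
  then show ?thesis
  proof cases
    case 1
    obtain r where r: "r < n" "\<bar>middle m r\<bar> = x"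
      using middle_surj[of "nat x" m] 1 x p pm by (auto simp: n nat_le_iff Suc_le_eq)
    \<comment> \<open>The column in which row \<open>r\<close> meets diagonal
      \<open>2 m + 1\<close>.\<close>
    define c where "c = (r + 2 * m) mod n"
    have c: "c < n" unfolding c_def by (rule mod_n(1))
    have "(c + 2 * m + 1) mod n = (c + (2 * m + 1)) mod n" by (simp add: add.assoc)
    also have "\<dots> = (r + 2 * m + (2 * m + 1)) mod n" unfolding c_def by (rule mod_add_left_eq)
    also have "r + 2 * m + (2 * m + 1) = r + n" by (simp add: n)
    also have "(r + n) mod n = r" using r by simp
    finally have "(c + 2 * m + 1) mod n = r" .
    then have "col_entry c (2 * m + 1) = Some (middle m r)"
      unfolding entry_def[OF c] using p pm by simp
    with p pm n show ?thesis by (intro cell_in_column[OF c _ _ r(2)]) auto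
  next
    case 2
    obtain r where r: "r < n" "outer m r = x \<or> 16 * int m + 5 - outer m r = x"
      using outer_surj[of m x] 2 p pm by (auto simp: n)
    from r(2) show ?thesis
    proof
      assume o: "outer m r = x"
      have "- middle m ((r + 2 * m + 1) mod n) - row_b (r + 1) = outer m r"
        unfolding middle_def n[symmetric] col_shift[OF r(1)] by (simp add: add_ac)
      then have e: "col_entry r 1 = Some x"
        unfolding entry_def[OF r(1)] using o by simp
      show ?thesis
        by (rule cell_in_column[OF r(1) _ e]) (use x p pm in \<open>simp_all add: n\<close>)
    next
      assume o: "16 * int m + 5 - outer m r = x"
      \<comment> \<open>Column \<open>c\<close> meets diagonal 0 in row \<open>c + 1\<close>, whose
        zigzag partner is \<open>r\<close> because \<open>2 m + 1 + 2 m = n\<close>.\<close>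
      define c where "c = (r + 2 * m) mod n"
      have c: "c < n" unfolding c_def by (rule mod_n(1))
      have "(c + 1 + 2 * m) mod n = (c + (2 * m + 1)) mod n" by (simp add: add_ac)
      also have "\<dots> = (r + 2 * m + (2 * m + 1)) mod n" unfolding c_def by (rule mod_add_left_eq)
      also have "r + 2 * m + (2 * m + 1) = r + n" by (simp add: n)
      also have "(r + n) mod n = r" using r by simp
      finally have "row_b (c + 1) = - x" using o by simp
      then have e: "col_entry c 0 = Some (- x)"
        unfolding entry_def[OF c] by simp
      show ?thesis
        by (rule cell_in_column[OF c n0 e]) (use x in simp)
    qed
  next
    case 3
    \<comment> \<open>Digits of \<open>e\<close>: \<open>j\<close> is the pair number,
      \<open>q\<close> selects one of the blocks of length \<open>n\<close> for \<open>x\<close>,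
      \<open>y\<close>, \<open>x + J\<close>, \<open>y + J\<close> in this order, and
      \<open>s\<close> is the place in the block.\<close>
    define e where "e = nat (x - 3 * int n - 1)"
    have xe: "x = 3 * int n + 1 + int e" using 3 by (simp add: e_def)
    define j where "j = e div (4 * n)"
    define q where "q = e mod (4 * n) div n"
    define s where "s = e mod n"
    have "e < 4 * n * p"
    proof -
      have "int e < 4 * int n * int p" using x(2) xe by (simp add: algebra_simps)
      also have "\<dots> = int (4 * n * p)" by simp
      finally show ?thesis by (simp only: of_nat_less_iff)
    qed
    then have j: "j < p" unfolding j_def by (simp add: less_mult_imp_div_less mult.commute)
    have q: "q < 4" unfolding q_def using n0 by (simp add: less_mult_imp_div_less)
    have s: "s < n" unfolding s_def using n0 by simp
    have "e = 4 * n * j + (n * q + s)"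
    proof -
      have "e mod (4 * n) mod n = s" unfolding s_def by (simp add: mod_mod_cancel)
      then show ?thesis
        unfolding j_def q_def by (metis mult_div_mod_eq)
    qed
    then have xe: "x = 3 * int n + 1 + 4 * int n * int j + int n * int q + int s"
      using xe by simp
    \<comment> \<open>For \<open>q \<ge> 2\<close> the entry contains the predecessor of its column,
      hence the shift by one.\<close>
    define c where "c = (s + 1) mod n"
    have c: "c < n" unfolding c_def by (rule mod_n(1))
    have cs: "(c + n - 1) mod n = s"
    proof -
      have "c + n - 1 = c + (n - 1)" using n0 by simp
      then have "(c + n - 1) mod n = (s + 1 + (n - 1)) mod n"
        unfolding c_def by (simp only: mod_add_left_eq)
      then show ?thesis using s n0 by simp
    qed
    consider "q = 0" | "q = 1" | "q = 2" | "q = 3" using q by linarith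
    then show ?thesis
    proof cases
      case 1
      have e: "col_entry s (2 * j + 2) = Some (- x)"
        unfolding entry_def[OF s] using j xe 1 by simp
      show ?thesis
        by (rule cell_in_column[OF s _ e]) (use j pm x in \<open>simp_all add: n\<close>)
    next
      case 2
      have e: "col_entry s (2 * m + (2 * j + 2)) = Some x"
        unfolding entry_def[OF s] using j pm xe 2 by simp
      show ?thesis
        by (rule cell_in_column[OF s _ e]) (use j pm x in \<open>simp_all add: n\<close>)
    next
      case 3
      have e: "col_entry c (2 * j + 3) = Some x"
        unfolding entry_def[OF c] unfolding cs using j xe 3 by simp
      show ?thesis
        by (rule cell_in_column[OF c _ e]) (use j pm x in \<open>simp_all add: n\<close>)
    next
      case 4
      have e: "col_entry c (2 * m + (2 * j + 3)) = Some (- x)"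
        unfolding entry_def[OF c] unfolding cs using j pm xe 4 by simp
      show ?thesis
        by (rule cell_in_column[OF c _ e]) (use j pm x in \<open>simp_all add: n\<close>)
    qed
  qed
qed

end

theorem theorem1p6:
  fixes n p :: nat
  assumes "[n = 1] (mod 4)"
    and "p > 0"
    and "n \<ge> 4 * p + 3"
  shows "\<exists>A. integer_heffter_array n (4 * p + 3) A \<and> globally_simple n (4 * p + 3) A"
proof -
  define m where "m = n div 4"
  have n: "n = 4 * m + 1"
    using assms(1) unfolding m_def cong_def by presburger
  have pm: "p < m"
    using assms(3) n by linarith
  let ?A = "heffter_cell m p"
  have rows: "row_entries n ?A r = List.map_filter (?A r) [0..<n]" for r
    by (simp add: row_entries_def List.map_filter_def o_def)
  have cols: "col_entries n ?A c = List.map_filter (\<lambda>r. ?A r c) [0..<n]" for c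
    by (simp add: col_entries_def List.map_filter_def o_def)
  note lines = row_line[OF \<open>p > 0\<close> pm n] col_line[OF \<open>p > 0\<close> pm n]
  have "heffter_array n (4 * p + 3) ?A"
    unfolding heffter_array_def rows cols
    using lines(1,2,4,5) heffter_cell_surj[OF \<open>p > 0\<close> pm n] by simp
  then have "integer_heffter_array n (4 * p + 3) ?A"
    unfolding integer_heffter_array_def rows cols using lines(2,5) by blast
  moreover have "globally_simple n (4 * p + 3) ?A"
    unfolding globally_simple_def rows cols using lines(3,6) by blast
  ultimately show ?thesis by blast
qed

end
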